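(* Let $G=(V,E)$ be a finite simple graph, let $r=\max\{|A| : A\in\operatorname{Stab}(G)\}$, and let $\operatorname{BP}(G)=\operatorname{conv}\{e_A : A\in\operatorname{Stab}(G),\ |A|=r\}\subseteq\mathbb{R}^V$. Then the diameter of $\operatorname{BP}(G)$ satisfies $\delta(\operatorname{BP}(G))\le r$.
   Context: For a finite set $X$, $\mathbb{R}^X$ denotes the real vector space with standard basis $\{e_x : x\in X\}$, and for $A\subseteq X$ the indicator vector is $e_A=\sum_{a\in A}e_a$. For a simple graph $G=(V,E)$, a subset $A\subseteq V$ is stable if no two vertices of $A$ are adjacent; $\operatorname{Stab}(G)$ is the set of stable sets. The diameter $\delta(P)$ of a polytope $P$ is the smallest number such that every pair of vertices of $P$ is connected in the $1$-skeleton of $P$ (the graph of vertices and edges of $P$) by a path of length at most $\delta(P)$. *)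

theory Defs
  imports "HOL-Analysis.Analysis" "Graph_Theory.Pair_Digraph"
begin

(* A finite simple graph is a pair_graph: a finite vertex set and a symmetric, irreflexive
   set of arcs, each edge being represented by its two orientations. *)

definition Stab :: "'v pair_pre_digraph \<Rightarrow> 'v set set" where
  "Stab G = {A. A \<subseteq> pverts G \<and> (\<forall>u\<in>A. \<forall>v\<in>A. (u, v) \<notin> parcs G)}"

definition stability_number :: "'v pair_pre_digraph \<Rightarrow> nat" where
  "stability_number G = Max (card ` Stab G)"

definition indicator_vec :: "'v set \<Rightarrow> real ^ 'v::finite" where
  "indicator_vec A = (\<Sum>a\<in>A. axis a 1)"

(* The vertex set of G may be a proper (possibly empty) subset of the finite type 'v. The space
   R^V is then the coordinate subspace of real ^ 'v spanned by the axis vectors of V, and BP G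
   lies in it; its faces do not depend on the ambient space. *)
definition BP :: "'v::finite pair_pre_digraph \<Rightarrow> (real ^ 'v) set" where
  "BP G = convex hull (indicator_vec ` {A \<in> Stab G. card A = stability_number G})"

(* An edge (1-dimensional face) of a polytope is the segment between two distinct vertices. *)
definition skeleton :: "'a::euclidean_space set \<Rightarrow> 'a pair_pre_digraph" where
  "skeleton P = \<lparr>pverts = {x. x extreme_point_of P},
                 parcs = {(u, v). closed_segment u v edge_of P}\<rparr>"

(* The value is taken in enat so that it is infinite if no bound exists. A path p is a list
   of arcs, so its length is the number of edges. *)
definition polytope_diameter :: "'a::euclidean_space set \<Rightarrow> enat" where
  "polytope_diameter P = Inf {enat k | k.
     \<forall>u\<in>pverts (skeleton P). \<forall>v\<in>pverts (skeleton P).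
       \<exists>p. pre_digraph.apath (with_proj (skeleton P)) u p v \<and> length p \<le> k}"

end

theory Submission
  imports Defs
begin

text \<open>For two maximum stable sets \<open>A\<close> and \<open>B\<close>, let \<open>C\<close> be a connected component of the graph
  induced on their symmetric difference.  Then \<open>sym_diff A C\<close> is again a maximum stable set,
  and its vertex is joined to that of \<open>A\<close> by an edge of the polytope because \<open>C\<close> is connected.
  Exchanging one component after another leads from \<open>A\<close> to \<open>B\<close>, and every exchange consumes an
  element of \<open>A - B\<close>.\<close>

lemma indicator_vec_nth [simp]: "indicator_vec A $ v = of_bool (v \<in> A)"
proof -
  have "indicator_vec A $ v = (\<Sum>a\<in>A. axis a 1 $ v)"
    by (simp add: indicator_vec_def)
  also have "\<dots> = (\<Sum>a\<in>A. if a = v then 1 else 0)"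
    by (intro sum.cong) (auto simp: axis_def)
  finally show ?thesis
    by simp
qed

lemma inj_indicator_vec: "inj (indicator_vec :: 'v::finite set \<Rightarrow> _)"
  by (auto intro!: injI simp: vec_eq_iff of_bool_eq_iff)

definition Max_Stab :: "'v pair_pre_digraph \<Rightarrow> 'v set set" where
  "Max_Stab G = {A \<in> Stab G. card A = stability_number G}"

lemma BP_eq: "BP G = convex hull (indicator_vec ` Max_Stab G)"
  by (simp add: BP_def Max_Stab_def)

lemma card_le_stability_number:
  fixes G :: "'v::finite pair_pre_digraph"
  assumes "A \<in> Stab G"
  shows "card A \<le> stability_number G"
  unfolding stability_number_def using assms by (intro Max_ge) auto

text \<open>A face of \<open>convex hull S\<close> is the hull of some
  \<open>T \<subseteq> S\<close>. For the face cut out by the hyperplane, all of \<open>T\<close>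
  lies on the hyperplane, which leaves only \<open>x\<close> and \<open>y\<close>.\<close>

lemma edge_of_convex_hull_if_supporting_hyperplane:
  fixes S :: "'a::euclidean_space set"
  assumes "finite S" "x \<in> S" "y \<in> S" "x \<noteq> y"
    and le: "\<And>z. z \<in> S \<Longrightarrow> c \<bullet> z \<le> b"
    and eq: "\<And>z. z \<in> S \<Longrightarrow> c \<bullet> z = b \<longleftrightarrow> z = x \<or> z = y"
  shows "closed_segment x y edge_of convex hull S"
proof -
  let ?F = "convex hull S \<inter> {z. c \<bullet> z = b}"
  have "convex hull S \<subseteq> {z. c \<bullet> z \<le> b}"
    using le by (intro hull_minimal) (auto simp: convex_halfspace_le)
  then have F: "?F face_of convex hull S"
    by (intro face_of_Int_supporting_hyperplane_le) auto
  then obtain T where T: "T \<subseteq> S" "?F = convex hull T"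
    using face_of_convex_hull_subset \<open>finite S\<close> finite_imp_compact by metis
  have "T \<subseteq> {x, y}"
    using T eq hull_subset[of T convex] by blast
  then have "?F \<subseteq> closed_segment x y"
    using T by (simp add: segment_convex_hull hull_mono)
  moreover have "closed_segment x y \<subseteq> ?F"
    using assms F by (intro closed_segment_subset) (auto simp: hull_inc face_of_imp_convex)
  ultimately have "?F = closed_segment x y"
    by blast
  then show ?thesis
    using F \<open>x \<noteq> y\<close> by (simp add: edge_of_def segment_convex_hull aff_dim_convex_hull)
qed

text \<open>Gives access to walks in the skeleton. The ends of a segment are extreme in it, and
  extreme points of a face are extreme in \<open>P\<close>.\<close>

lemma pair_wf_digraph_skeleton: "pair_wf_digraph (skeleton P)"
proof -
  have "u extreme_point_of P \<and> v extreme_point_of P" if "closed_segment u v edge_of P" for u v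
    using that extreme_point_of_face[of "closed_segment u v" P]
    by (auto simp: edge_of_def extreme_point_of_segment)
  then show ?thesis
    by unfold_locales (auto simp: skeleton_def)
qed

text \<open>The diameter asks for paths, whereas the exchanges yield walks. A path repeats no arc
  and \<open>awalk_to_apath\<close> only keeps arcs of the walk, so the path is no longer than the
  walk.\<close>

lemma (in wf_digraph) short_apath_if_awalk:
  assumes "awalk u p v"
  obtains q where "apath u q v" "length q \<le> length p"
proof
  let ?q = "awalk_to_apath p"
  show *: "apath u ?q v"
    using assms by (rule apath_awalk_to_apath)
  have "length ?q = card (set ?q)"
    using * distinct_verts_imp_distinct distinct_card by (metis apath_def)
  also have "\<dots> \<le> card (set p)"
    using assms by (intro card_mono awalk_to_apath_subset) auto
  also have "\<dots> \<le> length p"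
    by (rule card_length)
  finally show "length ?q \<le> length p" .
qed

text \<open>The supporting functional forces the coordinates in \<open>A \<inter> B\<close> to be 1, those outside
  \<open>A \<union> B\<close> to be 0, and \<open>x u + x v = 1\<close> on every edge inside \<open>sym_diff A B\<close>.  By connectedness
  the last condition leaves only the two choices given by the bipartition.\<close>

lemma edge_of_BP:
  fixes G :: "'v::finite pair_pre_digraph"
  assumes A: "A \<in> Max_Stab G" and B: "B \<in> Max_Stab G" and a: "a \<in> A - B"
    and conn: "\<And>v. v \<in> sym_diff A B \<Longrightarrow> (a, v) \<in> (parcs G \<inter> sym_diff A B \<times> sym_diff A B)\<^sup>*"
  shows "closed_segment (indicator_vec A) (indicator_vec B) edge_of BP G"
proof -
  let ?D = "sym_diff A B"
  let ?R = "parcs G \<inter> ?D \<times> ?D"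
  \<comment> \<open>Over maximum stable sets, each of the three terms is maximal at both
    \<open>A\<close> and \<open>B\<close>; \<open>b\<close> adds up these maxima: the size of
    \<open>A \<inter> B\<close>, zero, and one per arc of \<open>?R\<close>.\<close>
  define c :: "real ^ 'v" where
    "c = (\<Sum>v\<in>A \<inter> B. axis v 1) - (\<Sum>v\<in>-(A \<union> B). axis v 1)
       + (\<Sum>(u, v)\<in>?R. axis u 1 + axis v 1)"
  define b :: real where "b = (\<Sum>v\<in>A \<inter> B. 1) + (\<Sum>e\<in>?R. 1)"
  \<comment> \<open>The deficit from \<open>b\<close> at the vertex of \<open>S\<close>, split into
    terms that are nonnegative for stable \<open>S\<close> and so must vanish one by one.\<close>
  define gap :: "'v set \<Rightarrow> real" where
    "gap S = (\<Sum>v\<in>A \<inter> B. 1 - of_bool (v \<in> S)) + (\<Sum>v\<in>-(A \<union> B). of_bool (v \<in> S))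
       + (\<Sum>(u, v)\<in>?R. 1 - (of_bool (u \<in> S) + of_bool (v \<in> S)))" for S
  have c: "c \<bullet> indicator_vec S = b - gap S" for S
    by (simp add: c_def b_def gap_def inner_add_left inner_diff_left inner_sum_left inner_axis'
        sum_subtractf case_prod_unfold del: sum_constant)
  have stab: "(u, v) \<notin> parcs G" if "S \<in> Max_Stab G" "u \<in> S" "v \<in> S" for S u v
    using that by (auto simp: Max_Stab_def Stab_def)
  have nonneg: "0 \<le> (\<lambda>(u, v). 1 - (of_bool (u \<in> S) + of_bool (v \<in> S)) :: real) e"
    if "S \<in> Max_Stab G" "e \<in> ?R" for S e
    using that stab[of S "fst e" "snd e"] by (auto simp: case_prod_unfold)
  have gap_nonneg: "0 \<le> gap S" if "S \<in> Max_Stab G" for S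
    unfolding gap_def using nonneg[OF that]
    by (intro add_nonneg_nonneg sum_nonneg) (auto simp del: of_bool_eq_iff)
  have tight: "gap S = 0 \<longleftrightarrow> A \<inter> B \<subseteq> S \<and> S \<subseteq> A \<union> B \<and> (\<forall>(u, v)\<in>?R. u \<in> S \<longleftrightarrow> v \<notin> S)"
    if S: "S \<in> Max_Stab G" for S
  proof -
    let ?x = "\<Sum>v\<in>A \<inter> B. 1 - of_bool (v \<in> S) :: real"
      and ?y = "\<Sum>v\<in>-(A \<union> B). of_bool (v \<in> S) :: real"
      and ?z = "\<Sum>(u, v)\<in>?R. 1 - (of_bool (u \<in> S) + of_bool (v \<in> S)) :: real"
    have "?x \<ge> 0" "?y \<ge> 0"
      by (auto intro!: sum_nonneg)
    moreover have "?z \<ge> 0"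
      by (rule sum_nonneg) (use nonneg[OF S] in blast)
    ultimately have "gap S = 0 \<longleftrightarrow> ?x = 0 \<and> ?y = 0 \<and> ?z = 0"
      unfolding gap_def by linarith
    moreover have "?x = 0 \<longleftrightarrow> A \<inter> B \<subseteq> S"
      by (subst sum_nonneg_eq_0_iff) auto
    moreover have "?y = 0 \<longleftrightarrow> S \<subseteq> A \<union> B"
      by (subst sum_nonneg_eq_0_iff) auto
    moreover have "?z = 0 \<longleftrightarrow> (\<forall>(u, v)\<in>?R. u \<in> S \<longleftrightarrow> v \<notin> S)"
    proof (subst sum_nonneg_eq_0_iff)
      have "1 - (of_bool p + of_bool q) = (0::real) \<longleftrightarrow> p = (\<not> q)" for p q
        by simp
      then show "(\<forall>e\<in>?R. (case e of (u, v) \<Rightarrow> 1 - (of_bool (u \<in> S) + of_bool (v \<in> S))) = (0::real)) \<longleftrightarrow>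
          (\<forall>(u, v)\<in>?R. u \<in> S \<longleftrightarrow> v \<notin> S)"
        by (simp only: case_prod_unfold)
    qed (rule finite, rule nonneg[OF S])
    ultimately show ?thesis by blast
  qed
  \<comment> \<open>Outside \<open>A\<close>, elements of \<open>?D\<close> are in \<open>B\<close>,
    so any other arc would join two elements of one stable set.\<close>
  have bip: "u \<in> A \<longleftrightarrow> v \<notin> A" if "(u, v) \<in> ?R" for u v
    using that stab[OF A] stab[OF B] by blast
  have eq: "gap S = 0 \<longleftrightarrow> S = A \<or> S = B" if S: "S \<in> Max_Stab G" for S
  proof
    assume "gap S = 0"
    then have t: "A \<inter> B \<subseteq> S" "S \<subseteq> A \<union> B" "\<And>u v. (u, v) \<in> ?R \<Longrightarrow> u \<in> S \<longleftrightarrow> v \<notin> S"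
      using tight[OF S] by blast+
    \<comment> \<open>On \<open>?D\<close>, \<open>S\<close> agrees with \<open>A\<close> if it
      contains \<open>a\<close>, and with \<open>B\<close> otherwise. Along an arc, membership in
      \<open>S\<close> and in \<open>A\<close> both flip.\<close>
    have "(v \<in> S \<longleftrightarrow> a \<in> S) \<longleftrightarrow> v \<in> A" if "v \<in> ?D" for v
      using conn[OF that]
    proof (induction rule: rtrancl_induct)
      case base
      then show ?case using a by simp
    next
      case (step y z)
      then show ?case using bip t(3) by blast
    qed
    then show "S = A \<or> S = B"
      using t(1,2) by (cases "a \<in> S") blast+
  next
    assume "S = A \<or> S = B"
    then show "gap S = 0"
      using tight[OF S] bip by auto
  qed
  show ?thesis
    unfolding BP_eq
  proof (rule edge_of_convex_hull_if_supporting_hyperplane[where c = c and b = b])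
    show "indicator_vec A \<noteq> indicator_vec B"
      using a inj_indicator_vec by (auto dest: injD)
    show "c \<bullet> z = b \<longleftrightarrow> z = indicator_vec A \<or> z = indicator_vec B"
      if "z \<in> indicator_vec ` Max_Stab G" for z
      using that eq by (auto simp: c dest: injD[OF inj_indicator_vec])
  qed (use A B c gap_nonneg in auto)
qed

text \<open>Exchanging a component of the graph induced on the symmetric difference preserves the
  cardinality: otherwise one of the two possible exchanges would produce a stable set
  that is too large.\<close>

lemma exchange_component:
  fixes G :: "'v::finite pair_pre_digraph"
  assumes "sym (parcs G)" and A: "A \<in> Max_Stab G" and B: "B \<in> Max_Stab G"
    and "C \<subseteq> sym_diff A B"
    and closed: "\<And>u v. u \<in> C \<Longrightarrow> v \<in> sym_diff A B \<Longrightarrow> (u, v) \<in> parcs G \<Longrightarrow> v \<in> C"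
  shows "sym_diff A C \<in> Max_Stab G"
proof -
  \<comment> \<open>The new set is \<open>A - C\<close> together with \<open>C \<inter> B\<close>. A
    neighbour in \<open>A\<close> of an element of \<open>C \<inter> B\<close> is not in
    \<open>B\<close>, hence in \<open>?thesis\<close>-independent terms it lies in the symmetric
    difference and so in \<open>C\<close>. Stated for arbitrary sets because the roles of
    \<open>A\<close> and \<open>B\<close> get swapped.\<close>
  have exch: "sym_diff A C \<in> Stab G"
    if "A \<in> Stab G" "B \<in> Stab G" "C \<subseteq> sym_diff A B"
      "\<And>u v. u \<in> C \<Longrightarrow> v \<in> sym_diff A B \<Longrightarrow> (u, v) \<in> parcs G \<Longrightarrow> v \<in> C" for A B
    using that(1-3) that(4) \<open>sym (parcs G)\<close> unfolding Stab_def sym_def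
    by (simp add: subset_iff) blast
  \<comment> \<open>Both sides count \<open>S \<union> C\<close>.\<close>
  have card: "card (sym_diff S C) + card (C \<inter> S) = card S + card (C - S)" for S
    by (subst (1 2) card_Un_disjoint[symmetric]) (auto intro!: arg_cong[of _ _ card])
  have AB: "A \<in> Stab G" "B \<in> Stab G" "card A = stability_number G" "card B = stability_number G"
    using A B by (auto simp: Max_Stab_def)
  have "sym_diff A C \<in> Stab G" "sym_diff B C \<in> Stab G"
    using exch[of A B] exch[of B A] AB assms(4) closed by (auto simp: Un_commute)
  \<comment> \<open>Hence the two exchanges change the size by opposite amounts; neither can
    increase it, so both amounts are zero.\<close>
  moreover have "C - B = C \<inter> A" "C - A = C \<inter> B"
    using assms(4) by blast+
  ultimately show ?thesis
    using card[of A] card[of B] card_le_stability_number[of "sym_diff A C" G]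
      card_le_stability_number[of "sym_diff B C" G] AB
    by (simp add: Max_Stab_def)
qed

text \<open>Induction on \<open>card (A - B)\<close>, one edge per exchange. Extremality puts the
  last vertex in the skeleton, as the empty walk of the base case requires.\<close>

lemma awalk_skeleton_BP:
  fixes G :: "'v::finite pair_pre_digraph"
  assumes sym: "sym (parcs G)" and "A \<in> Max_Stab G" "B \<in> Max_Stab G"
    and "indicator_vec B extreme_point_of BP G"
  shows "\<exists>p. pre_digraph.awalk (with_proj (skeleton (BP G))) (indicator_vec A) p (indicator_vec B)
    \<and> length p \<le> card (A - B)"
  using assms(2)
proof (induction "card (A - B)" arbitrary: A rule: less_induct)
  case less
  interpret pair_wf_digraph "skeleton (BP G)"
    by (rule pair_wf_digraph_skeleton)
  have card: "card A = card B"
    using less.prems assms(3) by (simp add: Max_Stab_def)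
  show ?case
  proof (cases "A \<subseteq> B")
    case True
    then have "A = B"
      using card by (simp add: card_subset_eq)
    moreover have "indicator_vec B \<in> pverts (skeleton (BP G))"
      using assms(4) by (simp add: skeleton_def)
    ultimately have "awalk (indicator_vec A) [] (indicator_vec B)"
      by (simp add: awalk_Nil_iff)
    then show ?thesis by fastforce
  next
    case False
    then obtain a where a: "a \<in> A - B" by blast
    let ?D = "sym_diff A B"
    define C where "C = {v. (a, v) \<in> (parcs G \<inter> ?D \<times> ?D)\<^sup>*}"
    have "a \<in> C"
      by (simp add: C_def)
    have CD: "C \<subseteq> ?D"
      using a unfolding C_def by (auto elim: rtranclE)
    have C: "v \<in> C" if "u \<in> C" "v \<in> ?D" "(u, v) \<in> parcs G" for u v
      using that CD unfolding C_def by (blast intro: rtrancl_into_rtrancl)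
    let ?A = "sym_diff A C"
    have A': "?A \<in> Max_Stab G"
      using exchange_component[OF sym less.prems assms(3) CD] C by blast
    have eqC: "sym_diff A ?A = C"
      by blast
    \<comment> \<open>The edge criterion is applied to \<open>A\<close> and \<open>?A\<close>, whose
      symmetric difference is \<open>C\<close>; walks from \<open>a\<close> inside \<open>?D\<close>
      never leave \<open>C\<close>.\<close>
    have "(a, v) \<in> (parcs G \<inter> C \<times> C)\<^sup>*" if "v \<in> C" for v
    proof -
      have "(a, v) \<in> (parcs G \<inter> ?D \<times> ?D)\<^sup>*"
        using that by (simp add: C_def)
      then show ?thesis
      proof (induction rule: rtrancl_induct)
        case (step y z)
        then have "y \<in> C" "z \<in> C"
          unfolding C_def by (auto intro: rtrancl_into_rtrancl)
        with step show ?case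
          by (auto intro: rtrancl_into_rtrancl)
      qed simp
    qed
    then have edge: "closed_segment (indicator_vec A) (indicator_vec ?A) edge_of BP G"
      using a \<open>a \<in> C\<close> by (intro edge_of_BP[OF less.prems A', of a]) (simp_all only: eqC, auto)
    \<comment> \<open>What the exchange adds lies in \<open>B\<close>, and it removes at least
      \<open>a\<close>.\<close>
    have lt: "card (?A - B) < card (A - B)"
      using a \<open>a \<in> C\<close> CD by (intro psubset_card_mono) auto
    from less.hyps[OF lt A'] obtain p where
      p: "awalk (indicator_vec ?A) p (indicator_vec B)" "length p \<le> card (?A - B)"
      by blast
    have "(indicator_vec A, indicator_vec ?A) \<in> parcs (skeleton (BP G))"
      using edge by (simp add: skeleton_def)
    then have "awalk (indicator_vec A) ((indicator_vec A, indicator_vec ?A) # p) (indicator_vec B)"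
      using p by (simp add: awalk_Cons_iff)
    moreover have "length ((indicator_vec A, indicator_vec ?A) # p) \<le> card (A - B)"
      using p lt by simp
    ultimately show ?thesis by blast
  qed
qed

theorem theorem7p2:
  fixes G :: "'v::finite pair_pre_digraph"
  assumes "pair_graph G"
  shows "polytope_diameter (BP G) \<le> enat (stability_number G)"
proof -
  interpret G: pair_graph G by fact
  have sym: "sym (parcs G)"
    using G.pair_sym_arcs by (simp add: symmetric_def)
  interpret pair_wf_digraph "skeleton (BP G)"
    by (rule pair_wf_digraph_skeleton)
  have "\<exists>p. apath u p v \<and> length p \<le> stability_number G"
    if uv: "u \<in> pverts (skeleton (BP G))" "v \<in> pverts (skeleton (BP G))" for u v
  proof -
    have ext: "u extreme_point_of BP G" "v extreme_point_of BP G"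
      using uv by (simp_all add: skeleton_def)
    then obtain A B where AB: "A \<in> Max_Stab G" "B \<in> Max_Stab G"
      "u = indicator_vec A" "v = indicator_vec B"
      unfolding BP_eq using extreme_point_of_convex_hull by blast
    then obtain p where p: "awalk u p v" "length p \<le> card (A - B)"
      using awalk_skeleton_BP[OF sym, of A B] ext by blast
    obtain q where "apath u q v" "length q \<le> length p"
      using short_apath_if_awalk[OF p(1)] .
    moreover have "card (A - B) \<le> stability_number G"
      using AB(1) card_mono[of A "A - B"] by (auto simp: Max_Stab_def)
    ultimately show ?thesis
      using p(2) by force
  qed
  then show ?thesis
    unfolding polytope_diameter_def by (intro Inf_lower) blast
qed

end
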